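(* For every integer $n \geq 3$, $$R^{cl}(\omega+n,3) \;\leq\; \omega^2 \cdot n + \omega \cdot (R(2n-3,3)+1)+1 .$$
   Context: All arithmetic is ordinal arithmetic. For a set $X$ and $k\in\omega$, $[X]^k=\{Y\subseteq X: |Y|=k\}$. Given ordinals $\beta,\gamma$ and $X\subseteq\gamma$, $X$ is order-homeomorphic to $\beta$ if there is an order-isomorphism $f:X\to\beta$ which is also a homeomorphism, where $\beta$ carries the order topology and $X$ carries the subspace topology inherited from the order topology of $\gamma$. For ordinals $\alpha,\beta,\gamma$, write $\gamma\rightarrow(\alpha,\beta)^2$ if for every function $\mathfrak{c}:[\gamma]^2\to\{0,1\}$ there is $X\subseteq\gamma$ such that either $[X]^2\subseteq\mathfrak{c}^{-1}(0)$ and $X$ is order-homeomorphic to $\alpha$, or $[X]^2\subseteq\mathfrak{c}^{-1}(1)$ and $X$ is order-homeomorphic to $\beta$. The closed Ramsey number $R^{cl}(\alpha,\beta)$ is the least ordinal $\gamma$ with $\gamma\rightarrow(\alpha,\beta)^2$, should such an ordinal exist. $R(m,3)$ denotes the classical Ramsey number: the least $N\in\mathbb{N}$ such that every $\{0,1\}$-coloring of the pairs of an $N$-element set has an $m$-element set all of whose pairs have color $0$ or a $3$-element set all of whose pairs have color $1$. *)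

theory Defs
  imports "HOL-Analysis.Analysis" "HOL-Library.Ramsey"
begin

unbundle cardinal_syntax

text \<open>
  An ordinal is represented by a reflexive well-order on a subset of a type, namely on its
  field: \<open>natLeq\<close> is \<open>\<omega>\<close>, \<open>natLeq_on n\<close> is the finite ordinal \<open>n\<close>, and ordinals are compared by
  \<open>\<le>o\<close> and identified along \<open>=o\<close>.
\<close>

definition osum :: "'a rel \<Rightarrow> 'b rel \<Rightarrow> ('a + 'b) rel"  (infixl \<open>+\<^sub>o\<close> 65)
  where "r +\<^sub>o s = {(Inl x, Inl y) | x y. (x, y) \<in> r} \<union> {(Inr x, Inr y) | x y. (x, y) \<in> s}
                  \<union> {(Inl x, Inr y) | x y. x \<in> Field r \<and> y \<in> Field s}"

text \<open>The ordinal product \<open>r \<cdot> s\<close> consists of \<open>s\<close> copies of \<open>r\<close>: the second component is the more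
  significant one.\<close>

definition oprod :: "'a rel \<Rightarrow> 'b rel \<Rightarrow> ('a \<times> 'b) rel"  (infixl \<open>*\<^sub>o\<close> 70)
  where "r *\<^sub>o s = {((x, y), (x', y')) | x y x' y'.
                     x \<in> Field r \<and> x' \<in> Field r \<and> y \<in> Field s \<and> y' \<in> Field s \<and>
                     ((y, y') \<in> s \<and> y \<noteq> y' \<or> y = y' \<and> (x, x') \<in> r)}"

lemma Field_osum: "Field (r +\<^sub>o s) = Inl ` Field r \<union> Inr ` Field s"
proof
  show "Field (r +\<^sub>o s) \<subseteq> Inl ` Field r \<union> Inr ` Field s"
    by (rule subsetI, unfold Field_iff [of _ "r +\<^sub>o s"]) (auto simp: osum_def intro: FieldI1 FieldI2)
  have "(Inl x, Inl y) \<in> r +\<^sub>o s" if "(x, y) \<in> r" for x y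
    using that by (auto simp: osum_def)
  moreover have "(Inr x, Inr y) \<in> r +\<^sub>o s" if "(x, y) \<in> s" for x y
    using that by (auto simp: osum_def)
  ultimately show "Inl ` Field r \<union> Inr ` Field s \<subseteq> Field (r +\<^sub>o s)"
    by (auto simp: Field_iff) blast+
qed

lemma Well_order_osum:
  assumes "Well_order r" "Well_order s"
  shows "Well_order (r +\<^sub>o s)"
proof -
  have r: "Refl r" "trans r" "antisym r" "Total r" "wf (r - Id)"
    and s: "Refl s" "trans s" "antisym s" "Total s" "wf (s - Id)"
    using assms by (auto simp: order_on_defs)
  have "Refl (r +\<^sub>o s)"
    using r(1) s(1) unfolding refl_on_def Field_osum by (auto simp: osum_def)
  moreover have "trans (r +\<^sub>o s)"
  proof (rule transI)
    fix p q t assume "(p, q) \<in> r +\<^sub>o s" "(q, t) \<in> r +\<^sub>o s"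
    then show "(p, t) \<in> r +\<^sub>o s"
      using r(2) s(2) by (auto simp: osum_def dest: transD intro: FieldI1 FieldI2)
  qed
  moreover have "antisym (r +\<^sub>o s)"
    using r(3) s(3) unfolding antisym_def osum_def by auto
  moreover have "Total (r +\<^sub>o s)"
    using r(4) s(4) unfolding total_on_def Field_osum by (auto simp: osum_def) blast+
  moreover have "wf ((r +\<^sub>o s) - Id)"
  proof (rule wf_subset)
    let ?m = "case_sum (\<lambda>x. (0::nat, x, undefined)) (\<lambda>y. (1, undefined, y))"
    show "wf (inv_image (less_than <*lex*> (r - Id) <*lex*> (s - Id)) ?m)"
      using r(5) s(5) by blast
    show "(r +\<^sub>o s) - Id \<subseteq> inv_image (less_than <*lex*> (r - Id) <*lex*> (s - Id)) ?m"
      by (auto simp: osum_def)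
  qed
  moreover have "(r +\<^sub>o s) \<subseteq> Field (r +\<^sub>o s) \<times> Field (r +\<^sub>o s)"
    by (auto simp: Field_def)
  ultimately show ?thesis by (simp add: order_on_defs)
qed

lemma Field_oprod:
  assumes "Well_order r" "Well_order s"
  shows "Field (r *\<^sub>o s) = Field r \<times> Field s"
proof -
  have "Refl r" using assms by (auto simp: order_on_defs)
  then have "((x, y), (x, y)) \<in> r *\<^sub>o s" if "x \<in> Field r" "y \<in> Field s" for x y
    using that by (auto simp: oprod_def refl_on_def)
  then show ?thesis by (fastforce simp: oprod_def Field_def)
qed

lemma Well_order_oprod:
  assumes "Well_order r" "Well_order s"
  shows "Well_order (r *\<^sub>o s)"
proof -
  have r: "Refl r" "trans r" "antisym r" "Total r" "wf (r - Id)"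
    and s: "Refl s" "trans s" "antisym s" "Total s" "wf (s - Id)"
    using assms by (auto simp: order_on_defs)
  note F = Field_oprod[OF assms]
  have "Refl (r *\<^sub>o s)"
    using r(1) s(1) unfolding refl_on_def F by (auto simp: oprod_def)
  moreover have "trans (r *\<^sub>o s)"
  proof (rule transI)
    fix p q t assume "(p, q) \<in> r *\<^sub>o s" "(q, t) \<in> r *\<^sub>o s"
    then show "(p, t) \<in> r *\<^sub>o s"
      using r(2) s(2,3) unfolding oprod_def
      by (auto dest: antisymD intro: transD)
  qed
  moreover have "antisym (r *\<^sub>o s)"
    using r(3) s(3) unfolding antisym_def oprod_def by auto
  moreover have "Total (r *\<^sub>o s)"
    using r(4) s(4) r(1) unfolding total_on_def refl_on_def F by (auto simp: oprod_def)
  moreover have "wf ((r *\<^sub>o s) - Id)"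
  proof (rule wf_subset)
    show "wf (inv_image ((s - Id) <*lex*> (r - Id)) prod.swap)"
      using r(5) s(5) by blast
    show "(r *\<^sub>o s) - Id \<subseteq> inv_image ((s - Id) <*lex*> (r - Id)) prod.swap"
      by (auto simp: oprod_def)
  qed
  moreover have "(r *\<^sub>o s) \<subseteq> Field (r *\<^sub>o s) \<times> Field (r *\<^sub>o s)"
    by (auto simp: Field_def)
  ultimately show ?thesis by (simp add: order_on_defs)
qed

text \<open>The order topology: the open rays form a subbasis. The whole field is included as well, so that
  the point of a one-element order is covered.\<close>

definition order_top :: "'a rel \<Rightarrow> 'a topology"
  where "order_top r = topology_generated_by
           ({Field r} \<union> {underS r x | x. x \<in> Field r} \<union> {aboveS r x | x. x \<in> Field r})"

lemma topspace_order_top: "topspace (order_top r) = Field r"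
  unfolding order_top_def topology_generated_by_topspace
  by (auto simp: underS_def aboveS_def Field_def)

text \<open>Note that \<open>X\<close> carries the topology inherited from \<open>r\<close>, not the order topology of the
  restricted order.\<close>

definition order_homeomorphic :: "'a rel \<Rightarrow> 'a set \<Rightarrow> 'b rel \<Rightarrow> bool"
  where "order_homeomorphic r X b \<longleftrightarrow>
           (\<exists>f. iso (Restr r X) b f \<and> homeomorphic_map (subtopology (order_top r) X) (order_top b) f)"

definition closed_arrow :: "'g rel \<Rightarrow> 'a rel \<Rightarrow> 'b rel \<Rightarrow> bool"
  where "closed_arrow g a b \<longleftrightarrow>
           (\<forall>c \<in> nsets (Field g) 2 \<rightarrow> {0, 1::nat}. \<exists>X \<subseteq> Field g.
              (\<forall>e \<in> nsets X 2. c e = 0) \<and> order_homeomorphic g X a \<or>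
              (\<forall>e \<in> nsets X 2. c e = 1) \<and> order_homeomorphic g X b)"

text \<open>\<open>g\<close> is (a representative of) \<open>R\<^sup>c\<^sup>l(a, b)\<close>. For leastness it is enough to compare \<open>g\<close> with the
  well-orders on subsets of the same type: every smaller ordinal is isomorphic to a proper initial
  segment of \<open>g\<close>.\<close>

definition is_closed_ramsey :: "'g rel \<Rightarrow> 'a rel \<Rightarrow> 'b rel \<Rightarrow> bool"
  where "is_closed_ramsey g a b \<longleftrightarrow>
           Well_order g \<and> closed_arrow g a b \<and>
           (\<forall>h :: 'g rel. Well_order h \<and> closed_arrow h a b \<longrightarrow> g \<le>o h)"

definition ramsey_number :: "nat \<Rightarrow> nat \<Rightarrow> nat"
  where "ramsey_number m k = (LEAST N. partn_lst {..<N} [m, k] 2)"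

end

theory Submission
  imports Defs
begin

text \<open>
  Read colour 1 as the edges of a graph. A triangle is already a closed copy of \<open>3\<close>, so the task is
  to refute a triangle-free graph on \<open>\<omega>\<^sup>2 \<cdot> n + \<omega> \<cdot> (R + 1) + 1\<close>, where \<open>R = R(2n - 3, 3)\<close>, that has
  no edge-free closed copy of \<open>\<omega> + n\<close>: a limit point \<open>z\<close>, a sequence increasing to \<open>z\<close>, and \<open>n - 1\<close>
  points above \<open>z\<close>.

  Fix a nonprincipal ultrafilter on \<open>\<nat>\<close>. It turns a sequence converging to \<open>z\<close>, or a sequence of such
  sequences, into an ultrafilter \<open>Q\<close> of sets that accumulate at \<open>z\<close> from below; a property that holds
  on a set of \<open>Q\<close> is said to hold for the generic point. In a triangle-free graph the neighbours of one
  vertex form an edge-free set, and so do the vertices adjacent to the generic point of \<open>Q\<close>. A greedy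
  choice extracts from every set of \<open>Q\<close> an edge-free sequence increasing to \<open>z\<close>
  (\<open>edge_free_sequence\<close>). Two consequences carry the proof.
  \<^item> If \<open>z\<close> is not adjacent to the generic point of \<open>Q\<close>, then the points above \<open>z\<close> that are adjacent
    neither to \<open>z\<close> nor to that generic point contain no edge-free set of size \<open>n - 1\<close>. Hence every
    generic point further up is adjacent to one of the two (\<open>generic_above_adjacent\<close>).
  \<^item> An edge-free set that contains a limit point together with its generic point contains no generic
    point further up (\<open>edge_free_set_one_limit\<close>).

  There are \<open>n\<close> limits of limits \<open>P\<^sub>0 < \<dots> < P\<^bsub>n-1\<^esub>\<close>, and each is approached by two kinds of generic
  points, limit points and successors. No vertex is adjacent to both kinds, and \<open>P\<^sub>c\<close> itself is
  adjacent to exactly one of them. So every generic point above \<open>P\<^sub>c\<close> lies in \<open>I\<^sub>c \<union> I'\<^sub>c\<close>, where the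
  edge-free sets \<open>I\<^sub>c\<close> and \<open>I'\<^sub>c\<close> consist of the points adjacent to \<open>P\<^sub>c\<close> and of those adjacent to the
  other kind. Ramsey's theorem supplies \<open>2n - 3\<close> pairwise nonadjacent limit points \<open>q\<^sub>j\<close> above all
  \<open>P\<^sub>c\<close>; at most \<open>n - 2\<close> of them escape \<open>I\<^sub>c \<union> I'\<^sub>c\<close>, so for any two indices some \<open>q\<^sub>j\<close> is caught by
  both. From this it follows that \<open>P\<^sub>l\<close> lies neither in \<open>I\<^sub>i\<close> nor in \<open>I'\<^sub>i\<close> when \<open>i < l\<close>
  (\<open>P_uncovered\<close>). But then \<open>P\<^sub>0, \<dots>, P\<^bsub>n-1\<^esub>\<close>, with a sequence of the kind not adjacent to \<open>P\<^sub>0\<close>, is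
  an edge-free closed copy of \<open>\<omega> + n\<close>.
\<close>

section \<open>Ultrafilters and generic points\<close>

text \<open>
  Filters are ordered by refinement, so an ultrafilter is a minimal proper filter. Zorn's lemma
  applies because the infimum of a chain is proper as soon as all finite infima are.
\<close>

lemma ex_ultrafilter:
  assumes "F \<noteq> (bot :: 'a filter)"
  obtains U where "U \<le> F" "U \<noteq> bot"
    "\<And>\<phi>. eventually (\<lambda>x. \<not> \<phi> x) U \<longleftrightarrow> \<not> eventually \<phi> U"
proof -
  define A where "A = {G. G \<le> F \<and> G \<noteq> bot}"
  have "\<exists>U\<in>A. \<forall>G\<in>A. U \<ge> G \<longrightarrow> G = U"
  proof (rule predicate_Zorn)
    show "partial_order_on A (relation_of (\<ge>) A)"
      by (rule partial_order_on_relation_ofI) auto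
    fix C assume C: "C \<in> Chains (relation_of (\<ge>) A)"
    then have lin: "G \<le> H \<or> H \<le> G" if "G \<in> C" "H \<in> C" for G H
      using that by (auto simp: Chains_def relation_of_def)
    have CA: "C \<subseteq> A"
      using C by (auto simp: Chains_def relation_of_def)
    show "\<exists>U\<in>A. \<forall>G\<in>C. G \<ge> U"
    proof (cases "C = {}")
      case True
      then show ?thesis using assms by (auto simp: A_def)
    next
      case False
      have least: "\<exists>G\<in>X. \<forall>H\<in>X. G \<le> H" if "finite X" "X \<noteq> {}" "X \<subseteq> C" for X
        using that
      proof (induction X rule: finite_ne_induct)
        case (insert x X)
        then obtain G where "G \<in> X" "\<forall>H\<in>X. G \<le> H" by auto
        then show ?case using lin[of G x] insert.prems by (auto intro: order_trans)
      qed auto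
      have "Inf C \<noteq> bot"
      proof (rule Inf_filter_not_bot)
        fix X assume X: "X \<subseteq> C" "finite X"
        show "Inf X \<noteq> bot"
        proof (cases "X = {}")
          case True
          then have "F \<le> Inf X" by simp
          then show ?thesis using assms by (auto simp: bot_unique)
        next
          case False
          then obtain G where "G \<in> X" "\<forall>H\<in>X. G \<le> H" using least X by blast
          then have "G \<le> Inf X" "G \<noteq> bot"
            using X CA by (auto intro: Inf_greatest simp: A_def)
          then show ?thesis by (auto simp: bot_unique)
        qed
      qed
      moreover have "Inf C \<le> F"
        using False CA by (auto simp: A_def intro: Inf_lower2)
      ultimately show ?thesis by (auto simp: A_def intro!: bexI[of _ "Inf C"] Inf_lower)
    qed
  qed
  then obtain U where U: "U \<le> F" "U \<noteq> bot" and max: "\<forall>G\<in>A. G \<le> U \<longrightarrow> G = U"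
    by (auto simp: A_def)
  have min: "G = U" if "G \<le> U" "G \<noteq> bot" for G
    using max that U(1) order.trans[of G U F] by (auto simp: A_def)
  have "eventually (\<lambda>x. \<not> \<phi> x) U \<longleftrightarrow> \<not> eventually \<phi> U" for \<phi>
  proof
    assume "eventually (\<lambda>x. \<not> \<phi> x) U"
    then show "\<not> eventually \<phi> U"
      using U(2) by (auto dest: eventually_conj simp: trivial_limit_def)
  next
    \<comment> \<open>Otherwise \<open>U\<close> could be refined by the set of all \<open>x\<close> with \<open>\<phi> x\<close>.\<close>
    assume not: "\<not> eventually \<phi> U"
    show "eventually (\<lambda>x. \<not> \<phi> x) U"
    proof (rule ccontr)
      assume "\<not> eventually (\<lambda>x. \<not> \<phi> x) U"
      then have "inf U (principal {x. \<phi> x}) \<noteq> bot"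
        by (simp add: trivial_limit_def eventually_inf_principal)
      then have "inf U (principal {x. \<phi> x}) = U"
        by (intro min) auto
      moreover have "eventually \<phi> (inf U (principal {x. \<phi> x}))"
        by (simp add: eventually_inf_principal)
      ultimately show False using not by simp
    qed
  qed
  with U show ?thesis using that by blast
qed

text \<open>
  \<open>Q \<phi>\<close> reads: the generic point below \<open>z\<close> satisfies \<open>\<phi>\<close>. Ultrafilters are used as quantifiers, so that
  the iterated ones below are plain compositions. The condition on \<open>z\<close> is vacuous at the
  least element, hence the assumptions \<open>u0 < z\<close> in later lemmas.
\<close>

definition ultralimit :: "(('a::linorder \<Rightarrow> bool) \<Rightarrow> bool) \<Rightarrow> 'a \<Rightarrow> bool"
  where "ultralimit Q z \<longleftrightarrow>
           (\<forall>\<phi> \<psi>. Q (\<lambda>w. \<phi> w \<and> \<psi> w) \<longleftrightarrow> Q \<phi> \<and> Q \<psi>) \<and>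
           (\<forall>\<phi>. Q (\<lambda>w. \<not> \<phi> w) \<longleftrightarrow> \<not> Q \<phi>) \<and>
           (\<forall>u<z. Q (\<lambda>w. u < w \<and> w < z))"

definition increases_to :: "(nat \<Rightarrow> 'a::linorder) \<Rightarrow> 'a \<Rightarrow> bool"
  where "increases_to s z \<longleftrightarrow> strict_mono s \<and> (\<forall>k. s k < z) \<and> (\<forall>u<z. \<exists>k. u < s k)"

context
  fixes Q :: "('a::linorder \<Rightarrow> bool) \<Rightarrow> bool" and z
  assumes Q: "ultralimit Q z"
begin

lemma ultralimit_conj: "Q (\<lambda>w. \<phi> w \<and> \<psi> w) \<longleftrightarrow> Q \<phi> \<and> Q \<psi>"
  by (rule Q[unfolded ultralimit_def, THEN conjunct1, THEN spec, THEN spec])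

lemma ultralimit_not: "Q (\<lambda>w. \<not> \<phi> w) \<longleftrightarrow> \<not> Q \<phi>"
  by (rule Q[unfolded ultralimit_def, THEN conjunct2, THEN conjunct1, THEN spec])

lemma ultralimit_between: "u < z \<Longrightarrow> Q (\<lambda>w. u < w \<and> w < z)"
  by (rule Q[unfolded ultralimit_def, THEN conjunct2, THEN conjunct2, rule_format])

lemma ultralimit_disj: "Q (\<lambda>w. \<phi> w \<or> \<psi> w) \<longleftrightarrow> Q \<phi> \<or> Q \<psi>"
  using ultralimit_not[of "\<lambda>w. \<not> \<phi> w \<and> \<not> \<psi> w"]
  by (simp add: ultralimit_conj ultralimit_not)

lemma ultralimit_mono: "Q \<phi> \<Longrightarrow> (\<And>w. \<phi> w \<Longrightarrow> \<psi> w) \<Longrightarrow> Q \<psi>"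
proof -
  assume "Q \<phi>" "\<And>w. \<phi> w \<Longrightarrow> \<psi> w"
  then have "(\<lambda>w. \<phi> w \<and> \<psi> w) = \<phi>" by blast
  with \<open>Q \<phi>\<close> show "Q \<psi>" using ultralimit_conj[of \<phi> \<psi>] by simp
qed

lemma ultralimit_greater: "u < z \<Longrightarrow> Q (\<lambda>w. u < w)"
  by (rule ultralimit_mono[OF ultralimit_between]) auto

lemma ultralimit_less: "u < z \<Longrightarrow> Q (\<lambda>w. w < z)"
  by (rule ultralimit_mono[OF ultralimit_between]) auto

lemma ultralimit_True: "Q (\<lambda>w. True)"
  using ultralimit_disj[of "\<lambda>w. True" "\<lambda>w. False"] ultralimit_not[of "\<lambda>w. True"] by simp

lemma ultralimit_ex: "Q \<phi> \<Longrightarrow> \<exists>w. \<phi> w"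
  using ultralimit_mono[of \<phi> "\<lambda>w. False"] ultralimit_not[of "\<lambda>w. True"] ultralimit_True by auto

lemma ultralimit_common: "Q \<phi> \<Longrightarrow> Q \<psi> \<Longrightarrow> \<exists>w. \<phi> w \<and> \<psi> w"
  using ultralimit_conj[of \<phi> \<psi>] by (intro ultralimit_ex) simp

lemma ultralimit_ball: "finite S \<Longrightarrow> Q (\<lambda>w. \<forall>u\<in>S. \<phi> u w) \<longleftrightarrow> (\<forall>u\<in>S. Q (\<phi> u))"
  by (induction S rule: finite_induct) (simp_all add: ultralimit_True ultralimit_conj)

end

section \<open>Triangle-free graphs\<close>

definition edge_free :: "('a \<Rightarrow> 'a \<Rightarrow> bool) \<Rightarrow> 'a set \<Rightarrow> bool"
  where "edge_free E S \<longleftrightarrow> (\<forall>u\<in>S. \<forall>v\<in>S. \<not> E u v)"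

locale triangle_free =
  fixes E :: "'a::{linorder,countable} \<Rightarrow> 'a \<Rightarrow> bool"
  assumes sym: "E u v \<Longrightarrow> E v u"
    and no_triangle: "E u v \<Longrightarrow> E v w \<Longrightarrow> E u w \<Longrightarrow> False"
begin

lemma irrefl: "\<not> E u u"
  using no_triangle by blast

lemma edge_free_neighbours: "edge_free E {w. E v w}"
  unfolding edge_free_def using no_triangle sym by blast

text \<open>
  Two adjacent vertices that are both adjacent to the generic point form a triangle with it.
\<close>

lemma edge_free_generic_neighbours:
  assumes "ultralimit Q z"
  shows "edge_free E {w. Q (E w)}"
  unfolding edge_free_def
proof clarify
  fix u v assume "Q (E u)" "Q (E v)" "E u v"
  moreover obtain w where "E u w" "E v w"
    using ultralimit_common[OF assms, OF \<open>Q (E u)\<close> \<open>Q (E v)\<close>] by blast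
  ultimately show False using no_triangle by blast
qed

text \<open>
  Otherwise take a vertex \<open>w\<close> adjacent to the generic point, and then a neighbour of \<open>w\<close> that is
  adjacent to the generic point as well.
\<close>

lemma ultralimit_sparse:
  assumes "ultralimit Q z"
  shows "\<not> Q (\<lambda>w. Q (E w))"
proof
  assume *: "Q (\<lambda>w. Q (E w))"
  then obtain w where w: "Q (E w)" using ultralimit_ex[OF assms *] by blast
  then obtain v where "E w v" "Q (E v)"
    using ultralimit_common[OF assms, OF w *] by blast
  with \<open>Q (E w)\<close> edge_free_generic_neighbours[OF assms]
  show False by (auto simp: edge_free_def)
qed

text \<open>
  The sequence is chosen greedily among points satisfying \<open>\<phi>\<close> that are not adjacent to the generic
  point: each of them rules out only a negligible set of later choices. Dominating the enumeration
  \<open>from_nat\<close> wherever it stays below \<open>z\<close> makes the sequence cofinal in \<open>z\<close>.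
\<close>

lemma edge_free_sequence:
  assumes Q: "ultralimit Q z" and "Q \<phi>" and u0: "u0 < z"
  obtains s where "increases_to s z" "\<And>k. \<phi> (s k)" "edge_free E (range s)"
proof -
  define good where "good f k r \<longleftrightarrow> \<phi> r \<and> \<not> Q (E r) \<and> r < z \<and>
      (from_nat k < z \<longrightarrow> from_nat k < r) \<and> (\<forall>i\<in>{..<k}. f i < r \<and> \<not> E (f i) r)"
    for f :: "nat \<Rightarrow> 'a" and k r
  have "\<exists>s. \<forall>k. good s k (s k)"
  proof (rule dependent_wellorder_choice)
    fix f k assume "\<And>i. i < k \<Longrightarrow> good f i (f i)"
    then have f: "\<forall>i<k. \<not> Q (E (f i)) \<and> f i < z" by (auto simp: good_def)
    have "Q (\<lambda>r. \<forall>i\<in>{..<k}. f i < r \<and> \<not> E (f i) r)"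
      unfolding ultralimit_ball[OF Q finite_lessThan]
    proof
      fix i assume "i \<in> {..<k}"
      then have "f i < z" "\<not> Q (E (f i))" using f by auto
      then show "Q (\<lambda>r. f i < r \<and> \<not> E (f i) r)"
        using ultralimit_greater[OF Q \<open>f i < z\<close>]
        by (simp add: ultralimit_conj[OF Q] ultralimit_not[OF Q])
    qed
    moreover have "Q (\<lambda>r. r < z)"
      by (rule ultralimit_less[OF Q u0])
    moreover have "Q (\<lambda>r. from_nat k < z \<longrightarrow> from_nat k < r)"
      using ultralimit_greater[OF Q] ultralimit_True[OF Q] by (cases "from_nat k < z") simp_all
    moreover have "Q (\<lambda>r. \<not> Q (E r))"
      unfolding ultralimit_not[OF Q] by (rule ultralimit_sparse[OF Q])
    ultimately have "Q (good f k)"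
      using \<open>Q \<phi>\<close> unfolding good_def
      by (simp only: ultralimit_conj[OF Q])
    then show "\<exists>r. good f k r"
      by (rule ultralimit_ex[OF Q])
  qed (auto simp: good_def)
  then obtain s where s: "\<And>k. good s k (s k)" by blast
  have "increases_to s z"
    unfolding increases_to_def strict_mono_def
  proof (intro conjI allI impI)
    fix u assume "u < z"
    then show "\<exists>k. u < s k"
      using s[of "to_nat u"] unfolding good_def from_nat_to_nat by blast
  qed (use s in \<open>simp_all add: good_def\<close>)
  moreover have "edge_free E (range s)"
  proof -
    have "\<not> E (s i) (s j)" for i j
      using s[of i] s[of j] sym irrefl unfolding good_def lessThan_iff
      by (cases i j rule: linorder_cases) blast+
    then show ?thesis by (auto simp: edge_free_def)
  qed
  moreover have "\<phi> (s k)" for k using s[of k] by (simp add: good_def)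
  ultimately show ?thesis using that by blast
qed

end

section \<open>Graphs without an edge-free closed copy of \<open>\<omega> + n\<close>\<close>

definition closed_copy :: "nat \<Rightarrow> 'a::linorder set \<Rightarrow> bool"
  where "closed_copy n X \<longleftrightarrow> (\<exists>s z Z. increases_to s z \<and> finite Z \<and> card Z = n - 1 \<and> (\<forall>w\<in>Z. z < w) \<and>
           X = range s \<union> insert z Z)"

locale no_closed_copy = triangle_free E for E :: "'a::{linorder,countable} \<Rightarrow> 'a \<Rightarrow> bool" +
  fixes n :: nat and ub :: 'a
  assumes no_copy: "X \<subseteq> {..ub} \<Longrightarrow> edge_free E X \<Longrightarrow> \<not> closed_copy n X"
    and n2: "n \<ge> 2"
begin

text \<open>
  If all of \<open>insert z Z\<close> were nonadjacent to the generic point, an edge-free sequence of common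
  nonneighbours would complete it to a closed copy of \<open>\<omega> + n\<close>.
\<close>

lemma ex_generically_adjacent:
  assumes Q: "ultralimit Q z" and "u0 < z" and z: "\<not> Q (E z)"
    and Z: "Z \<subseteq> {z<..ub}" "finite Z" "card Z = n - 1" "edge_free E (insert z Z)"
  shows "\<exists>v\<in>Z. Q (E v)"
proof (rule ccontr)
  assume "\<not> (\<exists>v\<in>Z. Q (E v))"
  then have "\<forall>v\<in>insert z Z. Q (\<lambda>w. \<not> E v w)"
    using z by (simp add: ultralimit_not[OF Q])
  then have "Q (\<lambda>w. \<forall>v\<in>insert z Z. \<not> E v w)"
    using Z(2) by (subst ultralimit_ball[OF Q]) auto
  then obtain s where s: "increases_to s z" "\<And>k. \<forall>v\<in>insert z Z. \<not> E v (s k)"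
    "edge_free E (range s)"
    using edge_free_sequence[OF Q _ \<open>u0 < z\<close>, of "\<lambda>w. \<forall>v\<in>insert z Z. \<not> E v w"] by blast
  have "Z \<noteq> {}" using Z n2 by auto
  then have "z \<le> ub" using Z(1) by fastforce
  have "edge_free E (range s \<union> insert z Z)"
    unfolding edge_free_def
  proof (intro ballI notI)
    fix u v assume "u \<in> range s \<union> insert z Z" "v \<in> range s \<union> insert z Z" "E u v"
    then show False
      using s(2,3) Z(4) sym unfolding edge_free_def by blast
  qed
  moreover have "closed_copy n (range s \<union> insert z Z)"
    unfolding closed_copy_def using s(1) Z
    by (intro exI[of _ s] exI[of _ z] exI[of _ Z]) auto
  moreover have "s k \<le> ub" for k
    using s(1) \<open>z \<le> ub\<close> unfolding increases_to_def by (meson less_imp_le order.trans)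
  then have "range s \<union> insert z Z \<subseteq> {..ub}"
    using Z(1) \<open>z \<le> ub\<close> by auto
  ultimately show False using no_copy by blast
qed

text \<open>
  Below \<open>z'\<close> a failing generic point would yield a whole edge-free sequence of such points, of which
  the first \<open>n - 1\<close> contradict the previous lemma.
\<close>

lemma generic_above_adjacent:
  assumes Q: "ultralimit Q z" and "u0 < z" and z: "\<not> Q (E z)"
    and Q': "ultralimit Q' z'" "z < z'" "z' \<le> ub"
  shows "Q' (\<lambda>w. E z w \<or> Q (E w))"
proof (rule ccontr)
  define \<phi> where "\<phi> = (\<lambda>w. (z < w \<and> w < z') \<and> \<not> (E z w \<or> Q (E w)))"
  assume "\<not> Q' (\<lambda>w. E z w \<or> Q (E w))"
  then have "Q' (\<lambda>w. \<not> (E z w \<or> Q (E w)))"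
    by (subst ultralimit_not[OF Q'(1)])
  then have "Q' \<phi>"
    unfolding \<phi>_def using ultralimit_between[OF Q'(1,2)]
    by (subst ultralimit_conj[OF Q'(1)]) (rule conjI)
  then obtain s where s: "increases_to s z'" "\<And>k. \<phi> (s k)" "edge_free E (range s)"
    using edge_free_sequence[OF Q'(1) _ Q'(2), of \<phi>] by blast
  define Z where "Z = s ` {..<n - 1}"
  have "inj s" using s(1) by (simp add: increases_to_def strict_mono_imp_inj_on)
  then have "card Z = n - 1"
    unfolding Z_def by (subst card_image) (auto intro: inj_on_subset)
  moreover have "Z \<subseteq> {z<..ub}"
    using s(2) Q'(3) unfolding Z_def \<phi>_def by (fastforce intro: less_imp_le)
  moreover have "edge_free E (insert z Z)"
    using s(2,3) sym irrefl unfolding Z_def \<phi>_def edge_free_def by blast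
  ultimately obtain v where "v \<in> Z" "Q (E v)"
    using ex_generically_adjacent[OF Q \<open>u0 < z\<close> z, of Z] by (auto simp: Z_def)
  then show False using s(2) by (auto simp: Z_def \<phi>_def)
qed

text \<open>
  Points of \<open>I\<close> are not adjacent to the generic point of \<open>Q\<close>, since that point lies in \<open>I\<close> too. So the
  generic point of \<open>Q'\<close>, which is adjacent to \<open>z\<close> or to the generic point of \<open>Q\<close>, cannot lie in \<open>I\<close>.
\<close>

lemma edge_free_set_one_limit:
  assumes I: "edge_free E I" and Q: "ultralimit Q z" "u0 < z" "z \<in> I" "Q (\<lambda>w. w \<in> I)"
    and Q': "ultralimit Q' z'" "z < z'" "z' \<le> ub"
  shows "\<not> Q' (\<lambda>w. w \<in> I)"
proof
  assume "Q' (\<lambda>w. w \<in> I)"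
  have avoid: "\<not> Q (E v)" if "v \<in> I" for v
  proof
    assume "Q (E v)"
    then obtain w where "E v w" "w \<in> I"
      using ultralimit_common[OF Q(1), OF \<open>Q (E v)\<close> Q(4)] by blast
    then show False using I that by (auto simp: edge_free_def)
  qed
  have "Q' (\<lambda>w. E z w \<or> Q (E w))"
    by (rule generic_above_adjacent[OF Q(1,2) avoid[OF Q(3)] Q'])
  then obtain w where "w \<in> I" "E z w \<or> Q (E w)"
    using ultralimit_common[OF Q'(1), OF \<open>Q' (\<lambda>w. w \<in> I)\<close>] by blast
  then show False using I Q(3) avoid by (auto simp: edge_free_def)
qed

end

section \<open>Ordinals below \<open>\<omega>\<^sup>3\<close> and their limits\<close>

text \<open>
  \<open>Pos c b a\<close> is the ordinal \<open>\<omega>\<^sup>2 \<cdot> c + \<omega> \<cdot> b + a\<close>.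
\<close>

datatype pos = Pos nat nat nat

instance pos :: countable
  by countable_datatype

instantiation pos :: linorder
begin

fun less_pos :: "pos \<Rightarrow> pos \<Rightarrow> bool"
  where "Pos c b a < Pos c' b' a' \<longleftrightarrow> c < c' \<or> c = c' \<and> (b < b' \<or> b = b' \<and> a < a')"

definition less_eq_pos :: "pos \<Rightarrow> pos \<Rightarrow> bool"
  where "u \<le> v \<longleftrightarrow> u < v \<or> u = (v::pos)"

instance
proof
  fix u v w :: pos
  show "u < v \<longleftrightarrow> u \<le> v \<and> \<not> v \<le> u"
    by (cases u; cases v) (auto simp: less_eq_pos_def)
  show "u \<le> u" by (simp add: less_eq_pos_def)
  show "u \<le> v \<Longrightarrow> v \<le> w \<Longrightarrow> u \<le> w"
    by (cases u; cases v; cases w) (auto simp: less_eq_pos_def)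
  show "u \<le> v \<Longrightarrow> v \<le> u \<Longrightarrow> u = v"
    by (cases u; cases v) (auto simp: less_eq_pos_def)
  show "u \<le> v \<or> v \<le> u"
    by (cases u; cases v) (auto simp: less_eq_pos_def)
qed

end

instance pos :: wellorder
proof
  fix R :: "pos \<Rightarrow> bool" and u
  assume step: "\<And>u. (\<And>v. v < u \<Longrightarrow> R v) \<Longrightarrow> R u"
  let ?f = "\<lambda>u. case u of Pos c b a \<Rightarrow> (c, b, a)"
  have "{(u, v::pos). u < v} \<subseteq> inv_image (less_than <*lex*> less_than <*lex*> less_than) ?f"
    by (auto simp: inv_image_def split: pos.split)
  then have "wf {(u, v::pos). u < v}"
    by (rule wf_subset[rotated]) auto
  then show "R u"
    by (induction u rule: wf_induct_rule) (use step in auto)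
qed

lemma Pos_le [simp]:
  "Pos c b a \<le> Pos c' b' a' \<longleftrightarrow> c < c' \<or> c = c' \<and> (b < b' \<or> b = b' \<and> a \<le> a')"
  by (auto simp: less_eq_pos_def)

text \<open>
  The quantifier of one fixed nonprincipal ultrafilter on \<open>\<nat>\<close>. Using the same one everywhere lets
  statements about different limits be combined under a single quantifier.
\<close>

definition most :: "(nat \<Rightarrow> bool) \<Rightarrow> bool"
  where "most = (SOME V. (\<forall>\<phi> \<psi>. V (\<lambda>k. \<phi> k \<and> \<psi> k) \<longleftrightarrow> V \<phi> \<and> V \<psi>) \<and>
                       (\<forall>\<phi>. V (\<lambda>k. \<not> \<phi> k) \<longleftrightarrow> \<not> V \<phi>) \<and> (\<forall>m. V (\<lambda>k. m < k)))"

lemma most_conj: "most (\<lambda>k. \<phi> k \<and> \<psi> k) \<longleftrightarrow> most \<phi> \<and> most \<psi>"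
  and most_not: "most (\<lambda>k. \<not> \<phi> k) \<longleftrightarrow> \<not> most \<phi>"
  and most_greater: "most (\<lambda>k. m < k)"
proof -
  obtain U where U: "U \<le> sequentially" "U \<noteq> bot"
    "\<And>\<phi>. eventually (\<lambda>x. \<not> \<phi> x) U \<longleftrightarrow> \<not> eventually \<phi> U"
    using ex_ultrafilter[OF sequentially_bot] by blast
  let ?P = "\<lambda>V. (\<forall>\<phi> \<psi>. V (\<lambda>k. \<phi> k \<and> \<psi> k) \<longleftrightarrow> V \<phi> \<and> V \<psi>) \<and>
                (\<forall>\<phi>. V (\<lambda>k::nat. \<not> \<phi> k) \<longleftrightarrow> \<not> V \<phi>) \<and> (\<forall>m. V (\<lambda>k. m < k))"
  have "?P (\<lambda>\<phi>. eventually \<phi> U)"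
    using U(3) filter_leD[OF U(1) eventually_gt_at_top] by (simp add: eventually_conj_iff)
  then have most: "?P most"
    unfolding most_def by (rule someI[of ?P])
  show "most (\<lambda>k. \<phi> k \<and> \<psi> k) \<longleftrightarrow> most \<phi> \<and> most \<psi>"
    by (rule most[THEN conjunct1, THEN spec, THEN spec])
  show "most (\<lambda>k. \<not> \<phi> k) \<longleftrightarrow> \<not> most \<phi>"
    by (rule most[THEN conjunct2, THEN conjunct1, THEN spec])
  show "most (\<lambda>k. m < k)"
    by (rule most[THEN conjunct2, THEN conjunct2, THEN spec])
qed

lemma most_mono:
  assumes "most \<phi>" "\<And>k. \<phi> k \<Longrightarrow> \<psi> k"
  shows "most \<psi>"
proof -
  have "(\<lambda>k. \<phi> k \<and> \<psi> k) = \<phi>" using assms(2) by blast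
  then show ?thesis using most_conj[of \<phi> \<psi>] assms(1) by simp
qed

lemma most_True: "most (\<lambda>k. True)"
  by (rule most_mono[OF most_greater]) simp

text \<open>
  Generic points below the limits of the two kinds: \<open>near_block c b\<close> describes one in the block
  converging to \<open>Pos c (b + 1) 0\<close>. The limit of limits \<open>Pos (c + 1) 0 0\<close> is approached both by
  \<open>near_limits c\<close>, through limit points, and by \<open>near_successors c\<close>, through generic points of blocks.
  The index \<open>b + 1\<close> in \<open>near_limits\<close> makes its \<open>b\<close>-th point the limit of the \<open>b\<close>-th block.
\<close>

definition near_block :: "nat \<Rightarrow> nat \<Rightarrow> (pos \<Rightarrow> bool) \<Rightarrow> bool"
  where "near_block c b \<phi> \<longleftrightarrow> most (\<lambda>a. \<phi> (Pos c b a))"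

definition near_limits :: "nat \<Rightarrow> (pos \<Rightarrow> bool) \<Rightarrow> bool"
  where "near_limits c \<phi> \<longleftrightarrow> most (\<lambda>b. \<phi> (Pos c (b + 1) 0))"

definition near_successors :: "nat \<Rightarrow> (pos \<Rightarrow> bool) \<Rightarrow> bool"
  where "near_successors c \<phi> \<longleftrightarrow> most (\<lambda>b. near_block c b \<phi>)"

lemma ultralimit_near_block: "ultralimit (near_block c b) (Pos c (b + 1) 0)"
  unfolding ultralimit_def near_block_def
proof (intro conjI allI impI)
  fix u assume u: "u < Pos c (b + 1) 0"
  obtain c' b' a' where [simp]: "u = Pos c' b' a'" by (cases u)
  show "most (\<lambda>a. u < Pos c b a \<and> Pos c b a < Pos c (b + 1) 0)"
    by (rule most_mono[OF most_greater[of a']]) (use u in auto)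
qed (simp_all only: most_conj most_not)

lemma ultralimit_near_limits: "ultralimit (near_limits c) (Pos (c + 1) 0 0)"
  unfolding ultralimit_def near_limits_def
proof (intro conjI allI impI)
  fix u assume u: "u < Pos (c + 1) 0 0"
  obtain c' b' a' where [simp]: "u = Pos c' b' a'" by (cases u)
  show "most (\<lambda>b. u < Pos c (b + 1) 0 \<and> Pos c (b + 1) 0 < Pos (c + 1) 0 0)"
    by (rule most_mono[OF most_greater[of b']]) (use u in auto)
qed (simp_all only: most_conj most_not)

lemma ultralimit_near_successors: "ultralimit (near_successors c) (Pos (c + 1) 0 0)"
  unfolding ultralimit_def near_successors_def near_block_def
proof (intro conjI allI impI)
  fix u assume u: "u < Pos (c + 1) 0 0"
  obtain c' b' a' where [simp]: "u = Pos c' b' a'" by (cases u)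
  have "most (\<lambda>a. u < Pos c b a \<and> Pos c b a < Pos (c + 1) 0 0)" if "b' < b" for b
    by (rule most_mono[OF most_True]) (use u that in auto)
  then show "most (\<lambda>b. most (\<lambda>a. u < Pos c b a \<and> Pos c b a < Pos (c + 1) 0 0))"
    by (rule most_mono[OF most_greater])
qed (simp_all only: most_conj most_not)

section \<open>Refuting the graph\<close>

text \<open>
  The vertices are the ordinals up to \<open>\<omega>\<^sup>2 \<cdot> n + \<omega> \<cdot> (m + 1)\<close>. The set \<open>J\<close> leaves out the topmost limit
  \<open>q m\<close>, so that above every \<open>q j\<close> with \<open>j \<in> J\<close> there is still a block of generic points.
\<close>

locale omega_squared_graph = no_closed_copy E n "Pos n (m + 1) 0"
  for E :: "pos \<Rightarrow> pos \<Rightarrow> bool" and n m :: nat +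
  fixes J :: "nat set"
  assumes J: "J \<subseteq> {..<m}" "card J = 2 * n - 3"
    and J_free: "edge_free E ((\<lambda>j. Pos n (j + 1) 0) ` J)"
begin

abbreviation P :: "nat \<Rightarrow> pos"
  where "P c \<equiv> Pos (c + 1) 0 0"

abbreviation q :: "nat \<Rightarrow> pos"
  where "q j \<equiv> Pos n (j + 1) 0"

lemma zero_less_Pos_Suc: "Pos 0 0 0 < P c" "Pos 0 0 0 < Pos c (b + 1) 0"
  by auto

text \<open>
  Otherwise \<open>I\<close> would contain a limit point with its generic point, and \<open>near_limits c\<close> would provide a
  generic point of \<open>I\<close> further up.
\<close>

lemma not_both_near:
  assumes I: "edge_free E I" and "c < n"
  shows "\<not> (near_limits c (\<lambda>w. w \<in> I) \<and> near_successors c (\<lambda>w. w \<in> I))"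
proof
  assume both: "near_limits c (\<lambda>w. w \<in> I) \<and> near_successors c (\<lambda>w. w \<in> I)"
  then have "most (\<lambda>b. Pos c (b + 1) 0 \<in> I \<and> near_block c b (\<lambda>w. w \<in> I))"
    unfolding near_limits_def near_successors_def most_conj .
  then obtain b where b: "Pos c (b + 1) 0 \<in> I" "near_block c b (\<lambda>w. w \<in> I)"
    using most_mono[of _ "\<lambda>_. False"] most_not[of "\<lambda>_. True"] most_True by auto
  have "\<not> near_limits c (\<lambda>w. w \<in> I)"
    by (rule edge_free_set_one_limit[OF I ultralimit_near_block zero_less_Pos_Suc(2) b
          ultralimit_near_limits]) (use \<open>c < n\<close> in auto)
  then show False using both by blast
qed

lemma not_near_limit_and_block:
  assumes I: "edge_free E I" and "near_block n j (\<lambda>w. w \<in> I)"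
    and "near_block n (j + 1) (\<lambda>w. w \<in> I)" "j < m"
  shows "q j \<notin> I"
proof
  assume "q j \<in> I"
  then have "\<not> near_block n (j + 1) (\<lambda>w. w \<in> I)"
    by (rule edge_free_set_one_limit[OF I ultralimit_near_block zero_less_Pos_Suc(2) _
          assms(2) ultralimit_near_block]) (use assms(4) in auto)
  then show False using assms(3) by blast
qed

text \<open>
  The exceptions, being pairwise nonadjacent and nonadjacent to \<open>P c\<close>, would otherwise complete \<open>P c\<close> and an
  approaching sequence to a closed copy.
\<close>

lemma few_exceptions:
  assumes Q: "ultralimit Q (P c)" "\<not> Q (E (P c))" "c < n"
  shows "card {j\<in>J. \<not> (E (P c) (q j) \<or> Q (E (q j)))} \<le> n - 2"
proof (rule ccontr)
  assume "\<not> ?thesis"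
  then have "n - 1 \<le> card {j\<in>J. \<not> (E (P c) (q j) \<or> Q (E (q j)))}" by simp
  then obtain K where K: "K \<subseteq> {j\<in>J. \<not> (E (P c) (q j) \<or> Q (E (q j)))}" "card K = n - 1" "finite K"
    by (rule obtain_subset_with_card_n)
  have "\<exists>v\<in>q ` K. Q (E v)"
  proof (rule ex_generically_adjacent[OF Q(1) zero_less_Pos_Suc(1) Q(2)])
    show "q ` K \<subseteq> {P c<..Pos n (m + 1) 0}"
    proof
      fix w assume "w \<in> q ` K"
      then obtain j where "j \<in> J" "w = q j" using K(1) by blast
      then show "w \<in> {P c<..Pos n (m + 1) 0}"
        using J(1) Q(3) by auto
    qed
    show "card (q ` K) = n - 1"
      using K(2) by (subst card_image) (auto simp: inj_on_def)
    show "edge_free E (insert (P c) (q ` K))"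
      using K(1) J_free sym irrefl unfolding edge_free_def by blast
  qed (use K(3) in simp)
  then show False using K(1) by blast
qed

text \<open>
  Suppose \<open>P c\<close> is adjacent to neither kind of generic point. Every generic point above \<open>P c\<close> would
  have to be adjacent to both kinds or to \<open>P c\<close>, hence to \<open>P c\<close>. As this applies to all blocks above
  \<open>Pos n 0 0\<close>, no \<open>q j\<close> with \<open>j \<in> J\<close> is adjacent to \<open>P c\<close>. So at least \<open>n - 1\<close> of these \<open>2n - 3\<close> points are
  adjacent to the one kind and at least \<open>n - 1\<close> to the other, although no point is adjacent to both.
\<close>

lemma near_P:
  assumes "c < n"
  shows "near_limits c (E (P c)) \<or> near_successors c (E (P c))"
proof (rule ccontr)
  assume neither: "\<not> ?thesis"
  have all: "Q (E (P c))" if Q: "ultralimit Q z" "P c < z" "z \<le> Pos n (m + 1) 0" for Q z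
  proof (rule ccontr)
    assume "\<not> Q (E (P c))"
    moreover have "Q (\<lambda>w. E (P c) w \<or> near_limits c (E w))"
      by (rule generic_above_adjacent[OF ultralimit_near_limits zero_less_Pos_Suc(1) _ Q])
        (use neither in blast)
    moreover have "Q (\<lambda>w. E (P c) w \<or> near_successors c (E w))"
      by (rule generic_above_adjacent[OF ultralimit_near_successors zero_less_Pos_Suc(1) _ Q])
        (use neither in blast)
    ultimately have *: "Q (\<lambda>w. near_limits c (E w))" "Q (\<lambda>w. near_successors c (E w))"
      unfolding ultralimit_disj[OF Q(1)] by blast+
    obtain w where "near_limits c (E w)" "near_successors c (E w)"
      using ultralimit_common[OF Q(1), OF *] by blast
    then show False
      using not_both_near[OF edge_free_neighbours[of w] assms] by simp
  qed
  have near: "near_block n j (E (P c))" if "j \<le> m" for j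
    by (rule all[OF ultralimit_near_block]) (use that assms in auto)
  have "\<not> E (P c) (q j)" if "j < m" for j
    using not_near_limit_and_block[OF edge_free_neighbours[of "P c"], of j]
      near[of j] near[of "j + 1"] that by simp
  then have not_nbr: "\<not> E (P c) (q j)" if "j \<in> J" for j
    using J(1) that by blast
  have few: "card {j\<in>J. \<not> Q (E (q j))} \<le> n - 2"
    if "ultralimit Q (P c)" "\<not> Q (E (P c))" for Q
  proof -
    have "{j\<in>J. \<not> Q (E (q j))} = {j\<in>J. \<not> (E (P c) (q j) \<or> Q (E (q j)))}"
      using not_nbr by blast
    then show ?thesis using few_exceptions[OF that assms] by simp
  qed
  let ?A = "{j\<in>J. \<not> near_limits c (E (q j))}" and ?B = "{j\<in>J. \<not> near_successors c (E (q j))}"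
  have "finite J" using J(1) finite_subset by blast
  have "\<not> (near_limits c (E w) \<and> near_successors c (E w))" for w
    using not_both_near[OF edge_free_neighbours[of w] assms] by simp
  then have "J \<subseteq> ?A \<union> ?B" by blast
  then have "card J \<le> card (?A \<union> ?B)"
    using \<open>finite J\<close> by (intro card_mono) auto
  also have "\<dots> \<le> (n - 2) + (n - 2)"
    using few[OF ultralimit_near_limits] few[OF ultralimit_near_successors] neither
      card_Un_le[of ?A ?B] by linarith
  finally show False using J(2) n2 by simp
qed

text \<open>
  Of the two kinds of generic points below \<open>P c\<close>, the one adjacent to \<open>P c\<close> and the other one.
\<close>

definition near_joined :: "nat \<Rightarrow> (pos \<Rightarrow> bool) \<Rightarrow> bool"
  where "near_joined c = (if near_limits c (E (P c)) then near_limits c else near_successors c)"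

definition near_unjoined :: "nat \<Rightarrow> (pos \<Rightarrow> bool) \<Rightarrow> bool"
  where "near_unjoined c = (if near_limits c (E (P c)) then near_successors c else near_limits c)"

lemma ultralimit_near_joined: "ultralimit (near_joined c) (P c)"
  unfolding near_joined_def
  by (split if_split) (intro conjI impI ultralimit_near_limits ultralimit_near_successors)

lemma ultralimit_near_unjoined: "ultralimit (near_unjoined c) (P c)"
  unfolding near_unjoined_def
  by (split if_split) (intro conjI impI ultralimit_near_limits ultralimit_near_successors)

lemma near_joined_P: "c < n \<Longrightarrow> near_joined c (E (P c))"
  using near_P[of c] by (auto simp: near_joined_def)

lemma near_unjoined_P: "c < n \<Longrightarrow> \<not> near_unjoined c (E (P c))"
  using not_both_near[OF edge_free_neighbours[of "P c"], of c] by (auto simp: near_unjoined_def)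

lemma not_both_near_joined:
  assumes "edge_free E I" "c < n" "near_joined c (\<lambda>w. w \<in> I)"
  shows "\<not> near_unjoined c (\<lambda>w. w \<in> I)"
  using not_both_near[OF assms(1,2)] assms(3) by (auto simp: near_joined_def near_unjoined_def split: if_splits)

text \<open>
  The sets \<open>I\<^sub>c\<close> and \<open>I'\<^sub>c\<close> of the introduction.
\<close>

definition nbrs :: "nat \<Rightarrow> pos set"
  where "nbrs c = {w. E (P c) w}"

definition generic_nbrs :: "nat \<Rightarrow> pos set"
  where "generic_nbrs c = {w. near_unjoined c (E w)}"

lemma edge_free_nbrs: "edge_free E (nbrs c)"
  unfolding nbrs_def by (rule edge_free_neighbours)

lemma edge_free_generic_nbrs: "edge_free E (generic_nbrs c)"
  unfolding generic_nbrs_def by (rule edge_free_generic_neighbours[OF ultralimit_near_unjoined])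

lemma generic_covered:
  assumes "c < n" and Q: "ultralimit Q z" "P c < z" "z \<le> Pos n (m + 1) 0"
  shows "Q (\<lambda>w. w \<in> nbrs c \<union> generic_nbrs c)"
  unfolding nbrs_def generic_nbrs_def Un_iff mem_Collect_eq
  by (rule generic_above_adjacent[OF ultralimit_near_unjoined zero_less_Pos_Suc(1)
        near_unjoined_P[OF assms(1)] Q])

lemma few_uncovered:
  assumes "c < n"
  shows "card {j\<in>J. q j \<notin> nbrs c \<union> generic_nbrs c} \<le> n - 2"
  unfolding nbrs_def generic_nbrs_def Un_iff mem_Collect_eq
  by (rule few_exceptions[OF ultralimit_near_unjoined near_unjoined_P[OF assms] assms])

text \<open>
  Let \<open>I\<close> contain \<open>P l\<close> and \<open>u\<close>. As \<open>u\<close> is then not adjacent to \<open>P l\<close>, it is adjacent to the unjoined kind of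
  generic points below \<open>P l\<close>, which therefore lies in \<open>I'\<close>. The two kinds cannot both lie in \<open>I'\<close>, so
  the joined kind lies in \<open>I\<close>; but it is adjacent to \<open>P l\<close>.
\<close>

lemma P_notin:
  assumes I: "edge_free E I" and I': "edge_free E I'" and "l < n"
    and cover: "\<And>Q. ultralimit Q (P l) \<Longrightarrow> Q (\<lambda>w. w \<in> I \<union> I')"
    and u: "u \<in> I" "u \<in> nbrs l \<union> generic_nbrs l"
  shows "P l \<notin> I"
proof
  assume P: "P l \<in> I"
  then have "u \<notin> nbrs l"
    using I u(1) unfolding nbrs_def edge_free_def by blast
  then have "near_unjoined l (E u)" using u(2) by (simp add: generic_nbrs_def)
  then have "\<not> near_unjoined l (\<lambda>w. w \<in> I)"
    using ultralimit_common[OF ultralimit_near_unjoined, OF \<open>near_unjoined l (E u)\<close>, of "\<lambda>w. w \<in> I"] I u(1)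
    unfolding edge_free_def by blast
  then have "near_unjoined l (\<lambda>w. w \<in> I')"
    using cover[OF ultralimit_near_unjoined] unfolding Un_iff ultralimit_disj[OF ultralimit_near_unjoined]
    by blast
  then have "\<not> near_joined l (\<lambda>w. w \<in> I')"
    using not_both_near_joined[OF I' \<open>l < n\<close>] by blast
  then have *: "near_joined l (\<lambda>w. w \<in> I)"
    using cover[OF ultralimit_near_joined] unfolding Un_iff ultralimit_disj[OF ultralimit_near_joined]
    by blast
  show False
    using ultralimit_common[OF ultralimit_near_joined, OF near_joined_P[OF \<open>l < n\<close>] *] I P
    unfolding edge_free_def by blast
qed

text \<open>
  To be used with \<open>I\<close> and \<open>I'\<close> the sets \<open>nbrs i\<close> and \<open>generic_nbrs i\<close> in either order. If some block above
  all \<open>P c\<close> is generically in \<open>I\<close>, one of its points will do. Otherwise all these blocks are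
  generically in \<open>I'\<close>, which excludes every \<open>q j\<close> with \<open>j < m\<close> from \<open>I'\<close>. At most \<open>2 (n - 2) < 2n - 3\<close>
  of the points \<open>q j\<close> with \<open>j \<in> J\<close> are uncovered for \<open>i\<close> or for \<open>l\<close>, and any other one will do.
\<close>

lemma ex_covered_twice:
  assumes I': "edge_free E I'" and "i < n" "l < n"
    and cover: "I \<union> I' = nbrs i \<union> generic_nbrs i"
  shows "\<exists>u\<in>I. u \<in> nbrs l \<union> generic_nbrs l"
proof (cases "\<exists>j\<le>m. near_block n j (\<lambda>w. w \<in> I)")
  case True
  then obtain j where j: "j \<le> m" and I: "near_block n j (\<lambda>w. w \<in> I)" by blast
  have "near_block n j (\<lambda>w. w \<in> nbrs l \<union> generic_nbrs l)"
    by (rule generic_covered[OF \<open>l < n\<close> ultralimit_near_block]) (use j \<open>l < n\<close> in auto)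
  from ultralimit_common[OF ultralimit_near_block, OF I this]
  show ?thesis by (elim exE conjE) (rule bexI)
next
  case False
  have near: "near_block n j (\<lambda>w. w \<in> I')" if "j \<le> m" for j
  proof -
    have "near_block n j (\<lambda>w. w \<in> nbrs i \<union> generic_nbrs i)"
      by (rule generic_covered[OF \<open>i < n\<close> ultralimit_near_block]) (use that \<open>i < n\<close> in auto)
    then show ?thesis
      using False that
      by (simp only: cover[symmetric] Un_iff ultralimit_disj[OF ultralimit_near_block]) blast
  qed
  have I'q: "q j \<notin> I'" if "j < m" for j
    by (rule not_near_limit_and_block[OF I' near near]) (use that in auto)
  define B where "B c = {j\<in>J. q j \<notin> nbrs c \<union> generic_nbrs c}" for c
  have "finite J" using J(1) finite_subset by blast
  have "card (B i \<union> B l) \<le> (n - 2) + (n - 2)"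
    using few_uncovered[OF \<open>i < n\<close>] few_uncovered[OF \<open>l < n\<close>] card_Un_le[of "B i" "B l"]
    unfolding B_def by linarith
  also have "\<dots> < card J" using J(2) n2 by simp
  finally have "\<not> J \<subseteq> B i \<union> B l"
    using card_mono[of "B i \<union> B l" J] \<open>finite J\<close> by (auto simp: B_def)
  then obtain j where "j \<in> J" "q j \<in> nbrs i \<union> generic_nbrs i" "q j \<in> nbrs l \<union> generic_nbrs l"
    by (auto simp: B_def)
  moreover have "q j \<notin> I'" using I'q \<open>j \<in> J\<close> J(1) by auto
  ultimately show ?thesis using cover by blast
qed

text \<open>
  The roles of \<open>nbrs i\<close> and \<open>generic_nbrs i\<close> are interchangeable in the two preceding lemmas.
\<close>

lemma P_uncovered:
  assumes "i < l" "l < n"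
  shows "P l \<notin> nbrs i \<union> generic_nbrs i"
proof -
  have "i < n" using assms by simp
  have "P i < P l" "P l \<le> Pos n (m + 1) 0" using assms by auto
  note cover = generic_covered[OF \<open>i < n\<close> _ this]
  obtain u where u: "u \<in> nbrs i" "u \<in> nbrs l \<union> generic_nbrs l"
    using ex_covered_twice[OF edge_free_generic_nbrs \<open>i < n\<close> \<open>l < n\<close> refl] by blast
  obtain v where v: "v \<in> generic_nbrs i" "v \<in> nbrs l \<union> generic_nbrs l"
    using ex_covered_twice[OF edge_free_nbrs \<open>i < n\<close> \<open>l < n\<close> Un_commute] by blast
  have "P l \<notin> nbrs i"
    by (rule P_notin[of "nbrs i" "generic_nbrs i" l u])
      (use edge_free_nbrs edge_free_generic_nbrs \<open>l < n\<close> cover u in blast)+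
  moreover have "P l \<notin> generic_nbrs i"
    by (rule P_notin[of "generic_nbrs i" "nbrs i" l v])
      (use edge_free_nbrs edge_free_generic_nbrs \<open>l < n\<close> cover[unfolded Un_commute[of "nbrs i"]] v in blast)+
  ultimately show ?thesis by blast
qed

lemma inconsistent: False
proof -
  have "\<not> E (P i) (P l)" if "i < n" "l < n" for i l
    using P_uncovered[of i l] P_uncovered[of l i] that sym irrefl
    by (cases i l rule: linorder_cases) (auto simp: nbrs_def)
  then have "\<exists>v\<in>P ` {1..<n}. near_unjoined 0 (E v)"
    using n2
    by (intro ex_generically_adjacent[OF ultralimit_near_unjoined zero_less_Pos_Suc(1) near_unjoined_P])
      (auto simp: edge_free_def card_image inj_on_def)
  then show False
    using P_uncovered[of 0] by (auto simp: generic_nbrs_def)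
qed

end

section \<open>Recognising order-homeomorphic subsets\<close>

text \<open>
  The well-order \<open>r\<close> is presented by an order-isomorphism \<open>pt\<close> from a set \<open>D\<close> in a well-ordered type.
  The subspace topology always refines the order topology of \<open>Y\<close>. For the converse, a ray of \<open>r\<close>
  that divides \<open>Y\<close> must meet \<open>Y\<close> in an open ray of \<open>Y\<close>: initial rays do so by well-ordering, and the final
  ray above \<open>a\<close> does if the points of \<open>Y\<close> up to \<open>a\<close> have a maximum, which says that \<open>Y\<close> is closed under
  suprema bounded in \<open>D\<close>.
\<close>

lemma order_homeomorphicI:
  fixes r :: "'g rel" and b :: "'b rel" and pt :: "'a::wellorder \<Rightarrow> 'g"
  assumes F: "Field r = pt ` D" and le: "\<And>u v. u \<in> D \<Longrightarrow> v \<in> D \<Longrightarrow> (pt u, pt v) \<in> r \<longleftrightarrow> u \<le> v"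
    and "Y \<subseteq> D" and e: "bij_betw e (Field b) Y"
    and b: "\<And>x y. x \<in> Field b \<Longrightarrow> y \<in> Field b \<Longrightarrow> (x, y) \<in> b \<longleftrightarrow> e x \<le> e y"
    and max: "\<And>a. a \<in> D \<Longrightarrow> \<exists>y\<in>Y. y \<le> a \<Longrightarrow> \<exists>y\<in>Y. y \<le> a \<and> (\<forall>x\<in>Y. x \<le> a \<longrightarrow> x \<le> y)"
  shows "order_homeomorphic r (pt ` Y) b"
proof -
  have pt_eq: "pt u = pt v \<longleftrightarrow> u = v" if "u \<in> D" "v \<in> D" for u v
    using le[OF that] le[OF that(2,1)] le[OF that(1,1)] by auto
  have underS: "pt u \<in> underS r (pt a) \<longleftrightarrow> u < a" if "u \<in> D" "a \<in> D" for u a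
    using le[OF that] pt_eq[OF that] by (auto simp: underS_def)
  have aboveS: "pt u \<in> aboveS r (pt a) \<longleftrightarrow> a < u" if "u \<in> D" "a \<in> D" for u a
    using le[OF that(2,1)] pt_eq[OF that] by (auto simp: aboveS_def)
  have eY: "e x \<in> Y" if "x \<in> Field b" for x
    using e that by (auto simp: bij_betw_def)
  then have eD: "e x \<in> D" if "x \<in> Field b" for x
    using that \<open>Y \<subseteq> D\<close> by blast
  have e_eq: "e x = e y \<longleftrightarrow> x = y" if "x \<in> Field b" "y \<in> Field b" for x y
    using e that by (auto simp: bij_betw_def inj_on_def)
  have b_underS: "y \<in> underS b x \<longleftrightarrow> e y < e x" if "y \<in> Field b" "x \<in> Field b" for x y
    using b[OF that] e_eq[OF that] by (auto simp: underS_def)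
  have b_aboveS: "y \<in> aboveS b x \<longleftrightarrow> e x < e y" if "y \<in> Field b" "x \<in> Field b" for x y
    using b[OF that(2,1)] e_eq[OF that] by (auto simp: aboveS_def)
  have b_sub: "underS b x \<subseteq> Field b" "aboveS b x \<subseteq> Field b" for x
    by (auto simp: underS_def aboveS_def intro: FieldI1 FieldI2)
  define k where "k = pt \<circ> e"
  define f where "f = inv_into (Field b) k"
  have k: "bij_betw k (Field b) (pt ` Y)"
    unfolding k_def by (rule bij_betw_trans[OF e]) (use pt_eq \<open>Y \<subseteq> D\<close> in \<open>auto simp: bij_betw_def inj_on_def\<close>)
  have f: "bij_betw f (pt ` Y) (Field b)"
    unfolding f_def by (rule bij_betw_inv_into[OF k])
  have kf: "k (f y) = y" if "y \<in> pt ` Y" for y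
    using k that by (simp add: f_def bij_betw_inv_into_right)
  have fk: "f (k x) = x" if "x \<in> Field b" for x
    using k that by (simp add: f_def bij_betw_inv_into_left)
  have f_pt: "e (f (pt u)) = u" "f (pt u) \<in> Field b" if "u \<in> Y" for u
  proof -
    show "f (pt u) \<in> Field b" using f that by (auto simp: bij_betw_def)
    then show "e (f (pt u)) = u"
      using kf[of "pt u"] that pt_eq[of "e (f (pt u))" u] eY \<open>Y \<subseteq> D\<close> by (auto simp: k_def)
  qed
  have "pt u \<in> Field (Restr r (pt ` Y))" if "u \<in> Y" for u
    using that le[of u u] \<open>Y \<subseteq> D\<close> by (auto intro: FieldI1)
  then have F_Restr: "Field (Restr r (pt ` Y)) = pt ` Y"
    by (auto simp: Field_def)
  have "iso (Restr r (pt ` Y)) b f"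
    unfolding iso_iff2 F_Restr
  proof (intro conjI ballI f)
    fix x y assume "x \<in> pt ` Y" "y \<in> pt ` Y"
    then obtain u v where uv: "x = pt u" "y = pt v" "u \<in> Y" "v \<in> Y" by blast
    then show "(x, y) \<in> Restr r (pt ` Y) \<longleftrightarrow> (f x, f y) \<in> b"
      using le[of u v] b[of "f x" "f y"] f_pt[of u] f_pt[of v] \<open>Y \<subseteq> D\<close> by auto
  qed
  moreover have topF: "topspace (subtopology (order_top r) (pt ` Y)) = pt ` Y"
    using F \<open>Y \<subseteq> D\<close> by (auto simp: topspace_order_top)
  have open_r: "openin (order_top r) U" if "U \<in> {Field r} \<union> {underS r x | x. x \<in> Field r} \<union> {aboveS r x | x. x \<in> Field r}" for U
    unfolding order_top_def by (rule topology_generated_by_Basis[OF that])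
  have open_b: "openin (order_top b) U" if "U \<in> {Field b} \<union> {underS b x | x. x \<in> Field b} \<union> {aboveS b x | x. x \<in> Field b}" for U
    unfolding order_top_def by (rule topology_generated_by_Basis[OF that])
  have "continuous_map (subtopology (order_top r) (pt ` Y)) (order_top b) f"
    unfolding order_top_def[of b]
  proof (rule continuous_on_generated_topo, unfold topF)
    fix U assume "U \<in> {Field b} \<union> {underS b x | x. x \<in> Field b} \<union> {aboveS b x | x. x \<in> Field b}"
    then consider "U = Field b" | x where "x \<in> Field b" "U = underS b x"
      | x where "x \<in> Field b" "U = aboveS b x"
      by blast
    then show "openin (subtopology (order_top r) (pt ` Y)) (f -` U \<inter> pt ` Y)"
    proof cases
      case 1
      then have "f -` U \<inter> pt ` Y = Field r \<inter> pt ` Y"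
        using f_pt(2) F \<open>Y \<subseteq> D\<close> by auto
      then show ?thesis unfolding openin_subtopology using open_r by blast
    next
      case (2 x)
      have "e x \<in> D" using eY 2 \<open>Y \<subseteq> D\<close> by blast
      have "f (pt u) \<in> U \<longleftrightarrow> pt u \<in> underS r (pt (e x))" if "u \<in> Y" for u
        using b_underS[of "f (pt u)" x] underS[of u "e x"] f_pt[OF that] that 2 \<open>e x \<in> D\<close> \<open>Y \<subseteq> D\<close>
        by auto
      then have "f -` U \<inter> pt ` Y = underS r (pt (e x)) \<inter> pt ` Y" by blast
      moreover have "openin (order_top r) (underS r (pt (e x)))"
        using \<open>e x \<in> D\<close> F by (intro open_r) auto
      ultimately show ?thesis unfolding openin_subtopology by blast
    next
      case (3 x)
      have "e x \<in> D" using eY 3 \<open>Y \<subseteq> D\<close> by blast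
      have "f (pt u) \<in> U \<longleftrightarrow> pt u \<in> aboveS r (pt (e x))" if "u \<in> Y" for u
        using b_aboveS[of "f (pt u)" x] aboveS[of u "e x"] f_pt[OF that] that 3 \<open>e x \<in> D\<close> \<open>Y \<subseteq> D\<close>
        by auto
      then have "f -` U \<inter> pt ` Y = aboveS r (pt (e x)) \<inter> pt ` Y" by blast
      moreover have "openin (order_top r) (aboveS r (pt (e x)))"
        using \<open>e x \<in> D\<close> F by (intro open_r) auto
      ultimately show ?thesis unfolding openin_subtopology by blast
    qed
  qed (use f_pt(2) in auto)
  moreover have "continuous_map (order_top b) (order_top r) k"
    unfolding order_top_def[of r]
  proof (rule continuous_on_generated_topo, unfold topspace_order_top)
    fix U assume "U \<in> {Field r} \<union> {underS r x | x. x \<in> Field r} \<union> {aboveS r x | x. x \<in> Field r}"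
    then consider "U = Field r" | a where "a \<in> D" "U = underS r (pt a)"
      | a where "a \<in> D" "U = aboveS r (pt a)"
      unfolding F by blast
    then show "openin (order_top b) (k -` U \<inter> Field b)"
    proof cases
      case 1
      then have "k -` U \<inter> Field b = Field b"
        using eD F by (auto simp: k_def)
      then show ?thesis using open_b by simp
    next
      case (2 a)
      have *: "k -` U \<inter> Field b = {x\<in>Field b. e x < a}"
        using 2 eD underS by (auto simp: k_def)
      show ?thesis
      proof (cases "\<exists>x\<in>Field b. a \<le> e x")
        case False
        then have "{x\<in>Field b. e x < a} = Field b" by auto
        then show ?thesis using * open_b by simp
      next
        case True
        \<comment> \<open>The points of \<open>Y\<close> below \<open>a\<close> are those below the least point of \<open>Y\<close> that is not below \<open>a\<close>.\<close>
        define y where "y = (LEAST y. y \<in> Y \<and> a \<le> y)"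
        have y: "y \<in> Y \<and> a \<le> y"
          unfolding y_def by (rule LeastI_ex) (use True eY in blast)
        have least: "y \<le> e x" if "x \<in> Field b" "a \<le> e x" for x
          unfolding y_def by (rule Least_le) (use that eY in blast)
        obtain x0 where x0: "x0 \<in> Field b" "e x0 = y"
          using e y by (auto simp: bij_betw_def)
        have "{x\<in>Field b. e x < a} = underS b x0"
        proof (intro set_eqI)
          fix x
          show "x \<in> {x\<in>Field b. e x < a} \<longleftrightarrow> x \<in> underS b x0"
            using b_underS[of x x0] b_sub(1)[of x0] x0 y least[of x] by (cases "x \<in> Field b") force+
        qed
        then show ?thesis using * open_b[of "underS b x0"] x0 by auto
      qed
    next
      case (3 a)
      have *: "k -` U \<inter> Field b = {x\<in>Field b. a < e x}"
        using 3 eD aboveS by (auto simp: k_def)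
      show ?thesis
      proof (cases "\<exists>y\<in>Y. y \<le> a")
        case False
        then have "{x\<in>Field b. a < e x} = Field b" using eY by (auto simp: not_le)
        then show ?thesis using * open_b by simp
      next
        case True
        then obtain y where y: "y \<in> Y" "y \<le> a" "\<forall>x\<in>Y. x \<le> a \<longrightarrow> x \<le> y"
          using max 3 by blast
        obtain x0 where x0: "x0 \<in> Field b" "e x0 = y"
          using e y by (auto simp: bij_betw_def)
        have "{x\<in>Field b. a < e x} = aboveS b x0"
        proof (intro set_eqI)
          fix x
          show "x \<in> {x\<in>Field b. a < e x} \<longleftrightarrow> x \<in> aboveS b x0"
            using b_aboveS[of x x0] b_sub(2)[of x0] x0 y eY[of x] by (cases "x \<in> Field b") force+
        qed
        then show ?thesis using * open_b[of "aboveS b x0"] x0 by auto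
      qed
    qed
  qed (use eD F in \<open>auto simp: k_def\<close>)
  then have "continuous_map (order_top b) (subtopology (order_top r) (pt ` Y)) k"
    unfolding continuous_map_in_subtopology using eY by (auto simp: topspace_order_top k_def)
  ultimately show ?thesis
    unfolding order_homeomorphic_def homeomorphic_map_maps homeomorphic_maps_def topF topspace_order_top
    using kf fk by blast
qed

lemma order_homeomorphic_finite:
  fixes r :: "'g rel" and pt :: "'a::wellorder \<Rightarrow> 'g"
  assumes F: "Field r = pt ` D" and le: "\<And>u v. u \<in> D \<Longrightarrow> v \<in> D \<Longrightarrow> (pt u, pt v) \<in> r \<longleftrightarrow> u \<le> v"
    and Y: "Y \<subseteq> D" "finite Y"
  shows "order_homeomorphic r (pt ` Y) (natLeq_on (card Y))"
proof -
  obtain e where e: "bij_betw e {..<card Y} Y" and mono: "strict_mono_on {..<card Y} e"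
    using ex_bij_betw_strict_mono_card[OF Y(2)] .
  show ?thesis
  proof (rule order_homeomorphicI[OF F le Y(1)])
    show "bij_betw e (Field (natLeq_on (card Y))) Y"
      using e by (simp add: Field_natLeq_on lessThan_def)
    show "(x, y) \<in> natLeq_on (card Y) \<longleftrightarrow> e x \<le> e y"
      if "x \<in> Field (natLeq_on (card Y))" "y \<in> Field (natLeq_on (card Y))" for x y
      using that strict_mono_on_less_eq[OF mono, of x y] by (simp add: Field_natLeq_on)
    fix a assume "\<exists>y\<in>Y. y \<le> a"
    then have "Max {y\<in>Y. y \<le> a} \<in> {y\<in>Y. y \<le> a}"
      using Y(2) by (intro Max_in) auto
    then show "\<exists>y\<in>Y. y \<le> a \<and> (\<forall>x\<in>Y. x \<le> a \<longrightarrow> x \<le> y)"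
      using Y(2) by (auto intro!: bexI[of _ "Max {y\<in>Y. y \<le> a}"])
  qed
qed

text \<open>
  Below the limit \<open>z\<close> only finitely many points of the copy lie under a given \<open>a\<close>, since the sequence is
  cofinal; from \<open>z\<close> on the maximum is found among \<open>z\<close> and the finitely many points above it.
\<close>

lemma order_homeomorphic_closed_copy:
  fixes r :: "'g rel" and pt :: "'a::wellorder \<Rightarrow> 'g"
  assumes F: "Field r = pt ` D" and le: "\<And>u v. u \<in> D \<Longrightarrow> v \<in> D \<Longrightarrow> (pt u, pt v) \<in> r \<longleftrightarrow> u \<le> v"
    and Y: "Y \<subseteq> D" "closed_copy n Y" and "n > 0"
  shows "order_homeomorphic r (pt ` Y) (natLeq +\<^sub>o natLeq_on n)"
proof -
  obtain s z Z where s: "increases_to s z" and Z: "finite Z" "card Z = n - 1" "\<forall>w\<in>Z. z < w"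
    and Y_eq: "Y = range s \<union> insert z Z"
    using Y(2) unfolding closed_copy_def by blast
  have "card (insert z Z) = n" using Z \<open>n > 0\<close> by (subst card_insert_disjoint) auto
  then obtain t where t: "bij_betw t {..<n} (insert z Z)" and t_mono: "strict_mono_on {..<n} t"
    using ex_bij_betw_strict_mono_card[of "insert z Z"] Z(1) by auto
  have t_range: "z \<le> t i" if "i < n" for i
  proof -
    have "t i \<in> insert z Z" using t that by (auto simp: bij_betw_def)
    then show ?thesis using Z(3) by auto
  qed
  have s_less: "s i < z" for i using s by (simp add: increases_to_def)
  have s_mono: "strict_mono s" using s by (simp add: increases_to_def)
  have st: "s i < t j" if "j < n" for i j
    using s_less[of i] t_range[OF that] by (rule less_le_trans)
  define e where "e = case_sum s t"
  have Fb: "Field (natLeq +\<^sub>o natLeq_on n) = Inl ` UNIV \<union> Inr ` {..<n}"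
    by (simp add: Field_osum Field_natLeq Field_natLeq_on lessThan_def)
  have e_le: "(x, y) \<in> natLeq +\<^sub>o natLeq_on n \<longleftrightarrow> e x \<le> e y"
    if xy: "x \<in> Field (natLeq +\<^sub>o natLeq_on n)" "y \<in> Field (natLeq +\<^sub>o natLeq_on n)" for x y
  proof -
    consider i j where "x = Inl i" "y = Inl j" | i j where "x = Inl i" "y = Inr j" "j < n"
      | i j where "x = Inr i" "y = Inl j" "i < n"
      | i j where "x = Inr i" "y = Inr j" "i < n" "j < n"
      using xy unfolding Fb by blast
    then show ?thesis
    proof cases
      case (1 i j)
      then show ?thesis
        using strict_mono_less_eq[OF s_mono, of i j] by (simp add: e_def osum_def natLeq_def)
    next
      case (2 i j)
      then show ?thesis
        using st[of j i] by (simp add: e_def osum_def Field_natLeq Field_natLeq_on)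
    next
      case (3 i j)
      then show ?thesis
        using st[of i j] by (simp add: e_def osum_def)
    next
      case (4 i j)
      then show ?thesis
        using strict_mono_on_less_eq[OF t_mono, of i j] by (simp add: e_def osum_def)
    qed
  qed
  show ?thesis
  proof (rule order_homeomorphicI[OF F le Y(1) _ e_le])
    show "bij_betw e (Field (natLeq +\<^sub>o natLeq_on n)) Y"
      unfolding bij_betw_def
    proof
      have "antisym (natLeq +\<^sub>o natLeq_on n)"
        using Well_order_osum[OF natLeq_Well_order natLeq_on_Well_order[of n]]
        by (simp add: order_on_defs)
      then show "inj_on e (Field (natLeq +\<^sub>o natLeq_on n))"
        using e_le by (intro inj_onI) (rule antisymD, assumption, auto)
      show "e ` Field (natLeq +\<^sub>o natLeq_on n) = Y"
        using t unfolding Fb image_Un image_image e_def by (simp add: Y_eq bij_betw_def)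
    qed
  next
    fix a assume a: "\<exists>y\<in>Y. y \<le> a"
    have "finite {y\<in>Y. y \<le> a} \<or> z \<le> a"
    proof (cases "z \<le> a")
      case False
      then obtain k where k: "a < s k" using s unfolding increases_to_def not_le by blast
      have "{y\<in>Y. y \<le> a} \<subseteq> s ` {..<k}"
      proof
        fix y assume y: "y \<in> {y\<in>Y. y \<le> a}"
        then have "y < z" using False by auto
        then obtain i where "y = s i" using y Z(3) by (auto simp: Y_eq)
        moreover from this have "s i < s k" using y k by auto
        ultimately show "y \<in> s ` {..<k}"
          using strict_mono_less[OF s_mono] by auto
      qed
      then show ?thesis using finite_surj by blast
    qed simp
    then show "\<exists>y\<in>Y. y \<le> a \<and> (\<forall>x\<in>Y. x \<le> a \<longrightarrow> x \<le> y)"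
    proof
      assume "finite {y\<in>Y. y \<le> a}"
      moreover from this have "Max {y\<in>Y. y \<le> a} \<in> {y\<in>Y. y \<le> a}"
        using a by (intro Max_in) auto
      ultimately show ?thesis
        by (auto intro!: bexI[of _ "Max {y\<in>Y. y \<le> a}"])
    next
      assume "z \<le> a"
      let ?y = "Max {y\<in>insert z Z. y \<le> a}"
      have fin: "finite {y\<in>insert z Z. y \<le> a}" using Z(1) by simp
      then have "?y \<in> {y\<in>insert z Z. y \<le> a}"
        by (rule Max_in) (use \<open>z \<le> a\<close> in auto)
      moreover have le_y: "x \<le> ?y" if "x \<in> insert z Z" "x \<le> a" for x
        using fin that by (intro Max_ge) auto
      moreover have "s i \<le> ?y" for i
        using s_less[of i] le_y[of z] \<open>z \<le> a\<close> by auto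
      ultimately show ?thesis
        unfolding Y_eq by (intro bexI[of _ ?y]) auto
    qed
  qed
qed

section \<open>The ordinal \<open>\<omega>\<^sup>2 \<cdot> n + \<omega> \<cdot> m + 1\<close>\<close>

text \<open>
  Meant for positions up to \<open>Pos n m 0\<close>, the only one among them that reaches the last branch.
\<close>

fun ordinal_of_pos :: "nat \<Rightarrow> nat \<Rightarrow> pos \<Rightarrow> ((nat \<times> nat) \<times> nat + nat \<times> nat) + nat"
  where "ordinal_of_pos n m (Pos c b a) =
           (if c < n then Inl (Inl ((a, b), c)) else if b < m then Inl (Inr (a, b)) else Inr 0)"

abbreviation (input) bound :: "nat \<Rightarrow> nat \<Rightarrow> (((nat \<times> nat) \<times> nat + nat \<times> nat) + nat) rel"
  where "bound n m \<equiv> (natLeq *\<^sub>o natLeq) *\<^sub>o natLeq_on n +\<^sub>o natLeq *\<^sub>o natLeq_on m +\<^sub>o natLeq_on 1"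

lemma Well_order_bound: "Well_order (bound n m)"
  by (intro Well_order_osum Well_order_oprod natLeq_Well_order natLeq_on_Well_order)

lemma Field_oprod_natLeq:
  "Field (natLeq *\<^sub>o natLeq) = UNIV"
  "Field (natLeq *\<^sub>o natLeq_on m) = UNIV \<times> {x. x < m}"
  "Field ((natLeq *\<^sub>o natLeq) *\<^sub>o natLeq_on n) = UNIV \<times> {x. x < n}"
proof -
  have W: "Well_order (natLeq *\<^sub>o natLeq)"
    by (intro Well_order_oprod natLeq_Well_order)
  show "Field (natLeq *\<^sub>o natLeq) = UNIV"
    unfolding Field_oprod[OF natLeq_Well_order natLeq_Well_order] Field_natLeq by simp
  then show "Field ((natLeq *\<^sub>o natLeq) *\<^sub>o natLeq_on n) = UNIV \<times> {x. x < n}"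
    unfolding Field_oprod[OF W natLeq_on_Well_order] Field_natLeq_on by simp
  show "Field (natLeq *\<^sub>o natLeq_on m) = UNIV \<times> {x. x < m}"
    unfolding Field_oprod[OF natLeq_Well_order natLeq_on_Well_order] Field_natLeq Field_natLeq_on ..
qed

lemma Field_bound: "Field (bound n m) = ordinal_of_pos n m ` {..Pos n m 0}"
proof -
  have Fields: "Field (bound n m) =
      Inl ` (Inl ` (UNIV \<times> {x. x < n}) \<union> Inr ` (UNIV \<times> {x. x < m})) \<union> Inr ` {x. x < 1}"
    by (simp only: Field_osum Field_oprod_natLeq Field_natLeq_on)
  have "x \<in> ordinal_of_pos n m ` {..Pos n m 0}" if "x \<in> Field (bound n m)" for x
  proof -
    have "x \<in> {Inl (Inl ((a, b), c)) |a b c. c < n} \<union> {Inl (Inr (a, b)) |a b. b < m} \<union> {Inr 0}"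
      using that unfolding Fields by auto
    then consider a b c where "c < n" "x = Inl (Inl ((a, b), c))" | a b where "b < m" "x = Inl (Inr (a, b))"
      | "x = Inr 0"
      by blast
    then show ?thesis
    proof cases
      case (1 a b c)
      then show ?thesis by (intro image_eqI[of _ _ "Pos c b a"]) auto
    next
      case (2 a b)
      then show ?thesis by (intro image_eqI[of _ _ "Pos n b a"]) auto
    next
      case 3
      then show ?thesis by (intro image_eqI[of _ _ "Pos n m 0"]) auto
    qed
  qed
  moreover have "ordinal_of_pos n m u \<in> Field (bound n m)" if "u \<le> Pos n m 0" for u
    unfolding Fields using that by (cases u) (auto split: if_splits)
  ultimately show ?thesis by blast
qed

lemma osum_iff:
  "(Inl x, Inl y) \<in> r +\<^sub>o s \<longleftrightarrow> (x, y) \<in> r"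
  "(Inr x', Inr y') \<in> r +\<^sub>o s \<longleftrightarrow> (x', y') \<in> s"
  "(Inl x, Inr y') \<in> r +\<^sub>o s \<longleftrightarrow> x \<in> Field r \<and> y' \<in> Field s"
  "(Inr x', Inl y) \<notin> r +\<^sub>o s"
  by (auto simp: osum_def)

lemma ordinal_of_pos_le:
  assumes "u \<le> Pos n m 0" "v \<le> Pos n m 0"
  shows "(ordinal_of_pos n m u, ordinal_of_pos n m v) \<in> bound n m \<longleftrightarrow> u \<le> v"
proof -
  have natLeq: "(x, y) \<in> natLeq \<longleftrightarrow> x \<le> y" for x y
    by (simp add: natLeq_def)
  have nat2: "((a, b), (a', b')) \<in> natLeq *\<^sub>o natLeq_on m \<longleftrightarrow>
      b < m \<and> b' < m \<and> (b < b' \<or> b = b' \<and> a \<le> a')" for a b a' b'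
    by (auto simp: oprod_def Field_natLeq Field_natLeq_on natLeq)
  have nat3: "(((a, b), c), ((a', b'), c')) \<in> (natLeq *\<^sub>o natLeq) *\<^sub>o natLeq_on n \<longleftrightarrow>
      c < n \<and> c' < n \<and> (c < c' \<or> c = c' \<and> (b < b' \<or> b = b' \<and> a \<le> a'))" for a b c a' b' c'
    unfolding oprod_def[of "natLeq *\<^sub>o natLeq"] Field_oprod_natLeq Field_natLeq_on
    by (auto simp: oprod_def Field_natLeq natLeq)
  obtain c b a c' b' a' where uv: "u = Pos c b a" "v = Pos c' b' a'"
    by (cases u; cases v)
  have u: "c < n \<and> ordinal_of_pos n m u = Inl (Inl ((a, b), c)) \<or>
      c = n \<and> b < m \<and> ordinal_of_pos n m u = Inl (Inr (a, b)) \<or>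
      c = n \<and> b = m \<and> a = 0 \<and> ordinal_of_pos n m u = Inr 0"
    using assms(1) uv by auto
  have v: "c' < n \<and> ordinal_of_pos n m v = Inl (Inl ((a', b'), c')) \<or>
      c' = n \<and> b' < m \<and> ordinal_of_pos n m v = Inl (Inr (a', b')) \<or>
      c' = n \<and> b' = m \<and> a' = 0 \<and> ordinal_of_pos n m v = Inr 0"
    using assms(2) uv by auto
  have Field: "x \<in> Field ((natLeq *\<^sub>o natLeq) *\<^sub>o natLeq_on n +\<^sub>o natLeq *\<^sub>o natLeq_on m) \<longleftrightarrow>
      (case x of Inl p \<Rightarrow> snd p < n | Inr p \<Rightarrow> snd p < m)" for x
    unfolding Field_osum Field_oprod_natLeq by (cases x) auto
  have one: "(0, 0) \<in> natLeq_on 1" by simp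
  have Field1: "0 \<in> Field (natLeq_on 1)" unfolding Field_natLeq_on by simp
  from u v show ?thesis
    by (elim disjE conjE;
        simp only: osum_iff nat2 nat3 Field Field1 Field_oprod_natLeq one; auto simp: uv)
qed

section \<open>The upper bound\<close>

lemma partn_lst_ramsey_number: "partn_lst {..<ramsey_number m k} [m, k] 2"
  unfolding ramsey_number_def by (rule LeastI_ex) (rule ramsey_full)

lemma triangle_free_edge_free_set:
  assumes sym: "\<And>u v. E u v \<Longrightarrow> E v u"
    and no_triangle: "\<And>u v w. E u v \<Longrightarrow> E v w \<Longrightarrow> E u w \<Longrightarrow> False"
  obtains J where "J \<subseteq> {..<ramsey_number k 3}" "card J = k" "edge_free E (f ` J)"
proof -
  define g where "g e = (if \<exists>i j. e = {i, j} \<and> E (f i) (f j) then 1 else 0 :: nat)" for e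
  have g_pair: "g {i, j} = 1 \<longleftrightarrow> E (f i) (f j)" for i j
    using sym by (auto simp: g_def doubleton_eq_iff)
  have g: "g \<in> nsets {..<ramsey_number k 3} 2 \<rightarrow> {..<length [k, 3]}"
    by (auto simp: g_def)
  obtain i H where i: "i < length [k, 3]" and H: "H \<in> nsets {..<ramsey_number k 3} ([k, 3] ! i)"
    and mono: "g ` nsets H 2 \<subseteq> {i}"
    by (rule partn_lstE[OF partn_lst_ramsey_number g refl])
  have pair: "g {x, y} = i" if "x \<in> H" "y \<in> H" "x \<noteq> y" for x y
  proof -
    have "{x, y} \<in> nsets H 2" using that by (simp add: nsets_def)
    then show ?thesis using mono by blast
  qed
  consider "i = 0" | "i = 1" using i by fastforce
  then show ?thesis
  proof cases
    case 1
    have "\<not> E (f x) (f y)" if "x \<in> H" "y \<in> H" for x y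
      using pair[OF that] g_pair[of x y] 1 no_triangle by (cases "x = y") auto
    then show ?thesis
      using that[of H] H 1 by (auto simp: nsets_def edge_free_def)
  next
    case 2
    then have "card H = 3" using H by (simp add: nsets_def)
    then obtain x y z where "H = {x, y, z}" "x \<noteq> y" "y \<noteq> z" "x \<noteq> z"
      unfolding card_3_iff by blast
    then have "E (f x) (f y)" "E (f y) (f z)" "E (f x) (f z)"
      using pair g_pair 2 by auto
    then show ?thesis using no_triangle by blast
  qed
qed

text \<open>
  A colouring without a homogeneous copy defines, through its pairs of colour 1, exactly the kind of
  graph that was refuted.
\<close>

lemma closed_arrow_bound:
  fixes r :: "'g rel"
  assumes "n \<ge> 2" and F: "Field r = pt ` {..Pos n (ramsey_number (2 * n - 3) 3 + 1) 0}"
    and le: "\<And>u v. u \<le> Pos n (ramsey_number (2 * n - 3) 3 + 1) 0 \<Longrightarrow>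
      v \<le> Pos n (ramsey_number (2 * n - 3) 3 + 1) 0 \<Longrightarrow> (pt u, pt v) \<in> r \<longleftrightarrow> u \<le> v"
  shows "closed_arrow r (natLeq +\<^sub>o natLeq_on n) (natLeq_on 3)"
  unfolding closed_arrow_def
proof (rule ballI, rule ccontr)
  fix c assume c: "c \<in> nsets (Field r) 2 \<rightarrow> {0, 1::nat}"
  assume none: "\<not> (\<exists>X\<subseteq>Field r. (\<forall>e \<in> nsets X 2. c e = 0) \<and> order_homeomorphic r X (natLeq +\<^sub>o natLeq_on n) \<or>
              (\<forall>e \<in> nsets X 2. c e = 1) \<and> order_homeomorphic r X (natLeq_on 3))"
  define m where "m = ramsey_number (2 * n - 3) 3"
  define D where "D = {..Pos n (m + 1) 0}"
  note F = F[folded m_def, folded D_def]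
  have le: "(pt u, pt v) \<in> r \<longleftrightarrow> u \<le> v" if "u \<in> D" "v \<in> D" for u v
    using le that unfolding D_def m_def by blast
  define E where "E u v \<longleftrightarrow> u \<noteq> v \<and> u \<in> D \<and> v \<in> D \<and> c {pt u, pt v} = 1" for u v
  have sym: "E v u" if "E u v" for u v
    using that by (auto simp: E_def insert_commute)
  have pairs: "\<exists>u\<in>Y. \<exists>v\<in>Y. u \<noteq> v \<and> e = {pt u, pt v}" if "e \<in> nsets (pt ` Y) 2" for e Y
    using that by (auto simp: nsets_def card_2_iff) metis
  have no_triangle: False if "E u v" "E v w" "E u w" for u v w
  proof -
    let ?Y = "{u, v, w}"
    have "?Y \<subseteq> D" "card ?Y = 3" using that by (auto simp: E_def)
    then have "order_homeomorphic r (pt ` ?Y) (natLeq_on 3)"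
      using order_homeomorphic_finite[OF F le, of ?Y] by simp
    moreover have "c e = 1" if e: "e \<in> nsets (pt ` ?Y) 2" for e
    proof -
      obtain x y where xy: "x \<in> ?Y" "y \<in> ?Y" "x \<noteq> y" "e = {pt x, pt y}" using pairs[OF e] by blast
      then have "E x y" using \<open>E u v\<close> \<open>E v w\<close> \<open>E u w\<close> sym by blast
      then show ?thesis using xy by (simp add: E_def)
    qed
    moreover have "pt ` ?Y \<subseteq> Field r" using \<open>?Y \<subseteq> D\<close> F by blast
    ultimately show False using none by blast
  qed
  have no_copy: "\<not> closed_copy n Y" if Y: "Y \<subseteq> D" "edge_free E Y" for Y
  proof
    assume "closed_copy n Y"
    then have "order_homeomorphic r (pt ` Y) (natLeq +\<^sub>o natLeq_on n)"
      using order_homeomorphic_closed_copy[OF F le Y(1)] \<open>n \<ge> 2\<close> by simp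
    moreover have "c e = 0" if e: "e \<in> nsets (pt ` Y) 2" for e
    proof -
      obtain x y where xy: "x \<in> Y" "y \<in> Y" "x \<noteq> y" "e = {pt x, pt y}" using pairs[OF e] by blast
      then have "c e \<noteq> 1" using Y by (auto simp: E_def edge_free_def)
      moreover have "e \<in> nsets (Field r) 2"
        using e Y(1) F nsets_mono[of "pt ` Y" "Field r"] by blast
      then have "c e \<in> {0, 1}" using c by blast
      ultimately show ?thesis by blast
    qed
    moreover have "pt ` Y \<subseteq> Field r" using Y(1) F by blast
    ultimately show False using none by blast
  qed
  obtain J where J: "J \<subseteq> {..<m}" "card J = 2 * n - 3" "edge_free E ((\<lambda>j. Pos n (j + 1) 0) ` J)"
    by (rule triangle_free_edge_free_set[of E "2 * n - 3" "\<lambda>j. Pos n (j + 1) 0", folded m_def,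
          OF sym no_triangle])
  interpret omega_squared_graph E n m J
    by unfold_locales (use sym no_triangle no_copy J \<open>n \<ge> 2\<close> in \<open>auto simp: D_def\<close>)
  show False by (rule inconsistent)
qed

theorem theorem2:
  fixes n :: nat
  assumes "n \<ge> 3"
  shows "\<exists>g :: nat rel. is_closed_ramsey g (natLeq +\<^sub>o natLeq_on n) (natLeq_on 3) \<and>
             g \<le>o (natLeq *\<^sub>o natLeq) *\<^sub>o natLeq_on n
                    +\<^sub>o natLeq *\<^sub>o natLeq_on (ramsey_number (2 * n - 3) 3 + 1)
                    +\<^sub>o natLeq_on 1"
proof -
  define m where "m = ramsey_number (2 * n - 3) 3 + 1"
  \<comment> \<open>The bound is countable, so it has a copy \<open>h\<close> on natural numbers, and the least well-order on
    natural numbers with the partition property lies below \<open>h\<close>.\<close>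
  define h :: "nat rel" where "h = dir_image (bound n m) to_nat"
  have Wh: "Well_order h" and iso: "bound n m =o h"
    unfolding h_def
    by (rule Well_order_dir_image dir_image_ordIso, rule Well_order_bound, rule inj_on_subset[OF inj_to_nat], simp)+
  have "closed_arrow h (natLeq +\<^sub>o natLeq_on n) (natLeq_on 3)"
  proof (rule closed_arrow_bound[of n h "to_nat \<circ> ordinal_of_pos n m", folded m_def])
    show "Field h = (to_nat \<circ> ordinal_of_pos n m) ` {..Pos n m 0}"
      unfolding h_def dir_image_Field Field_bound image_comp ..
    fix u v assume "u \<le> Pos n m 0" "v \<le> Pos n m 0"
    then show "((to_nat \<circ> ordinal_of_pos n m) u, (to_nat \<circ> ordinal_of_pos n m) v) \<in> h \<longleftrightarrow> u \<le> v"
      using ordinal_of_pos_le[of u n m v] by (simp add: h_def dir_image_def)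
  qed (use assms in simp)
  define S where "S = {g :: nat rel. Well_order g \<and> closed_arrow g (natLeq +\<^sub>o natLeq_on n) (natLeq_on 3)}"
  have "h \<in> S" using Wh \<open>closed_arrow h _ _\<close> by (simp add: S_def)
  then have "S \<noteq> {}" and "\<forall>g\<in>S. Well_order g" by (auto simp only: S_def)
  then obtain g where "g \<in> S" and least: "\<forall>g'\<in>S. g \<le>o g'"
    using exists_minim_Well_order by blast
  then have "is_closed_ramsey g (natLeq +\<^sub>o natLeq_on n) (natLeq_on 3)"
    unfolding is_closed_ramsey_def S_def mem_Collect_eq by blast
  moreover have "g \<le>o bound n m"
    by (rule ordLeq_ordIso_trans[OF bspec[OF least \<open>h \<in> S\<close>] ordIso_symmetric[OF iso]])
  ultimately show ?thesis unfolding m_def by (intro exI conjI)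
qed

end
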